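(* Let $d=2$ and let $f$ be a potential with values in $(0,\infty)$ on $\mathbb T\setminus\{0\}$. If $\log f$ is $5$-equispacing, then the $5$-point Fibonacci lattice $$\Phi_5=\left\{(0,0),\left(\tfrac15,\tfrac35\right),\left(\tfrac25,\tfrac15\right),\left(\tfrac35,\tfrac45\right),\left(\tfrac45,\tfrac25\right)\right\}$$ is an energy minimizer for the corresponding energy $E_F$, i.e. $E_F(Y)\ge E_F(\Phi_5)$ for every $5$-point configuration $Y$ in $\mathbb T^2$. In particular, this holds if (a) $f$ is decreasing and logarithmically convex on $(0,1/2]$; or (b) $f(t)=h(\cos(2\pi t))$ and $\log h$ is absolutely monotone on $[-1,1)$.
   Context: $\mathbb T=\mathbb R/\mathbb Z$ is identified with $[0,1)$. A potential $f$ on $\mathbb T$ is viewed as an even $1$-periodic function on $\mathbb R$, continuous on $(0,1)$; moreover either $f$ is continuous on all of $\mathbb R$ (with $f(0)\in(0,\infty)$), or it is singular at $0$, i.e. $\lim_{t\to0}f(t)=+\infty$ and $f(0)=+\infty$ (with $\log(+\infty)=+\infty$). "Decreasing" means non-increasing; logarithmically convex means that $\log f$ is convex. Energy: $F(t_1,t_2)=f(t_1)f(t_2)$ and, for a (multi)set $X=\{\mathbf x^0,\dots,\mathbf x^{N-1}\}\subset\mathbb T^2$, $E_F(X)=\sum_{k\ne\ell}f(x_1^k-x_1^\ell)f(x_2^k-x_2^\ell)$, the sum over ordered pairs $k\neq\ell$ in $\{0,\dots,N-1\}$. $N$-equispacing: a function $g$ on $\mathbb T$ is $N$-equispacing if for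 all $x^0,\dots,x^{N-1}\in[0,1)$ one has $\sum_{k\ne\ell}g(x^k-x^\ell)\ge\sum_{k\neq\ell}g\left(\frac kN-\frac\ell N\right)$. A function $u:[-1,1)\to\mathbb R$ is called absolutely monotone here (up to an additive constant) if it is $C^\infty$ and $u^{(k)}(s)\ge0$ for all $s\in(-1,1)$ and all integers $k\ge1$. In (b), the identity $f(t)=h(\cos(2\pi t))$ is for $t\notin\mathbb Z$, with $h:[-1,1)\to(0,\infty)$. *)

theory Defs
  imports "HOL-Analysis.Analysis"
begin

(* Functions on the circle are 1-periodic functions on the reals.  They take values in ereal
   because a singular potential has the value \<infinity> at the integers. *)

definition potential :: "(real \<Rightarrow> ereal) \<Rightarrow> bool" where
  "potential f \<longleftrightarrow>
     (\<forall>t. f (- t) = f t) \<and> (\<forall>t. f (t + 1) = f t) \<and>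
     (\<forall>t. t \<notin> \<int> \<longrightarrow> \<bar>f t\<bar> \<noteq> \<infinity>) \<and> continuous_on {0<..<1} f \<and>
     (continuous_on UNIV f \<and> 0 < f 0 \<and> f 0 < \<infinity> \<or> (f \<longlongrightarrow> \<infinity>) (at 0) \<and> f 0 = \<infinity>)"

(* The logarithm on [0, \<infinity>]; negative arguments are irrelevant. *)
definition ln_ext :: "ereal \<Rightarrow> ereal" where
  "ln_ext x = (if x = \<infinity> then \<infinity> else if x \<le> 0 then -\<infinity> else ereal (ln (real_of_ereal x)))"

definition offdiag :: "nat \<Rightarrow> (nat \<times> nat) set" where
  "offdiag N = {(k, l). k < N \<and> l < N \<and> k \<noteq> l}"

definition equispacing :: "nat \<Rightarrow> (real \<Rightarrow> ereal) \<Rightarrow> bool" where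
  "equispacing N g \<longleftrightarrow>
     (\<forall>x :: nat \<Rightarrow> real. (\<forall>k<N. x k \<in> {0..<1}) \<longrightarrow>
        (\<Sum>(k, l)\<in>offdiag N. g (x k - x l)) \<ge>
        (\<Sum>(k, l)\<in>offdiag N. g (real k / real N - real l / real N)))"

(* A finite multiset of points of the torus is represented by a list of points of [0,1)^2. *)
type_synonym configuration = "(real \<times> real) list"

definition torus_configuration :: "nat \<Rightarrow> configuration \<Rightarrow> bool" where
  "torus_configuration N X \<longleftrightarrow> length X = N \<and> set X \<subseteq> {0..<1} \<times> {0..<1}"

definition tensor_energy :: "(real \<Rightarrow> ereal) \<Rightarrow> configuration \<Rightarrow> ereal" where
  "tensor_energy f X =
     (\<Sum>(k, l)\<in>offdiag (length X).
        f (fst (X ! k) - fst (X ! l)) * f (snd (X ! k) - snd (X ! l)))"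

definition energy_minimizer :: "(real \<Rightarrow> ereal) \<Rightarrow> nat \<Rightarrow> configuration \<Rightarrow> bool" where
  "energy_minimizer f N X \<longleftrightarrow>
     torus_configuration N X \<and>
     (\<forall>Y. torus_configuration N Y \<longrightarrow> tensor_energy f Y \<ge> tensor_energy f X)"

definition Fibonacci5 :: configuration where
  "Fibonacci5 = [(0, 0), (1/5, 3/5), (2/5, 1/5), (3/5, 4/5), (4/5, 2/5)]"

(* D k is the k-th derivative of u on [-1,1), one-sided at -1; it is unique there, since a
   derivative within [-1,1) is.  The condition k >= 1 makes the notion insensitive to adding
   constants to u. *)
definition absolutely_monotone :: "(real \<Rightarrow> real) \<Rightarrow> bool" where
  "absolutely_monotone u \<longleftrightarrow>
     (\<exists>D :: nat \<Rightarrow> real \<Rightarrow> real.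
        (\<forall>s\<in>{-1..<1}. D 0 s = u s) \<and>
        (\<forall>k. \<forall>s\<in>{-1..<1}. (D k has_real_derivative D (Suc k) s) (at s within {-1..<1})) \<and>
        (\<forall>k\<ge>1. \<forall>s\<in>{-1<..<1}. D k s \<ge> 0))"

end

(* With c = f(1/5) f(2/5), all 20 ordered pairs of the Fibonacci lattice contribute c.  The tangent
   inequality z >= c (1 + ln z - ln c), the exponential form of AM-GM, bounds the energy of any
   configuration below by sums of log f over the two coordinate projections, to which equispacing
   applies.

   (a) Around the circle the 5 sorted points have consecutive gaps summing to 1 and second-neighbour
   gaps summing to 2; use the support lines of log f at the averages 1/5 and 2/5.

   (b) As in Cohn and Kumar's universal optimality, u = log h is bounded below by its cubic Hermite
   interpolant at cos(4 pi/5) and cos(2 pi/5), each doubled.  Its coefficients of s, s^2, s^3 are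
   nonnegative, so up to a constant it is a nonnegative combination of cos(2 pi j t), j <= 3, and the
   sum of cos(2 pi j (x_k - x_l)) over all k, l is |sum_k exp(2 pi i j x_k)|^2, which vanishes on the
   regular pentagon for j = 1, 2, 3. *)

theory Submission
  imports Defs
begin

section \<open>Sums over ordered pairs of distinct indices\<close>

lemma finite_offdiag [simp]: "finite (offdiag N)"
  by (rule finite_subset[of _ "{..<N} \<times> {..<N}"]) (auto simp: offdiag_def)

text \<open>A form that can be computed: for \<open>N = 5\<close> the simplifier expands the double
  sum into its 20 nonzero-index terms.\<close>

lemma sum_offdiag:
  fixes F :: "nat \<Rightarrow> nat \<Rightarrow> 'a :: comm_monoid_add"
  shows "(\<Sum>(k, l)\<in>offdiag N. F k l) = (\<Sum>k<N. \<Sum>l<N. if k = l then 0 else F k l)"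
proof -
  have "(\<Sum>k<N. \<Sum>l<N. if k = l then 0 else F k l)
      = (\<Sum>(k, l)\<in>{..<N} \<times> {..<N}. if k = l then 0 else F k l)"
    by (simp add: sum.cartesian_product)
  also have "\<dots> = (\<Sum>(k, l)\<in>offdiag N. if k = l then 0 else F k l)"
    by (rule sum.mono_neutral_right) (auto simp: offdiag_def)
  also have "\<dots> = (\<Sum>(k, l)\<in>offdiag N. F k l)"
    by (rule sum.cong) (auto simp: offdiag_def)
  finally show ?thesis by simp
qed

lemma lessThan_5: "{..<5::nat} = {0, 1, 2, 3, 4}"
  by auto

lemma card_offdiag_5: "card (offdiag 5) = 20"
proof -
  have "card (offdiag 5) = (\<Sum>(k, l)\<in>offdiag 5. 1)"
    by (simp add: case_prod_unfold)
  also have "\<dots> = (\<Sum>k<5. \<Sum>l<5::nat. if k = l then 0 else 1)"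
    by (rule sum_offdiag)
  also have "\<dots> = 20"
    by (simp add: lessThan_5)
  finally show ?thesis .
qed

lemma sum_offdiag_permute:
  assumes "p permutes {..<N}"
  shows "(\<Sum>(k, l)\<in>offdiag N. F (p k) (p l)) = (\<Sum>(k, l)\<in>offdiag N. F k l)"
proof -
  have p: "inj p" "\<And>k. p k < N \<longleftrightarrow> k < N"
    using permutes_inj[OF assms] permutes_in_image[OF assms] by auto
  have "bij_betw (map_prod p p) (offdiag N) (offdiag N)"
  proof (rule bij_betw_imageI)
    show "inj_on (map_prod p p) (offdiag N)"
      using p by (auto simp: inj_on_def inj_def)
    show "map_prod p p ` offdiag N = offdiag N"
    proof (intro equalityI subsetI)
      fix z assume "z \<in> offdiag N"
      then obtain k l where z: "z = (k, l)" "k < N" "l < N" "k \<noteq> l"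
        by (auto simp: offdiag_def)
      have inv: "p (inv p k) = k" "p (inv p l) = l"
        using permutes_surj[OF assms] by (simp_all add: surj_f_inv_f)
      then have "z = map_prod p p (inv p k, inv p l)" using z by simp
      moreover have "inv p k \<noteq> inv p l" using inv z(4) by metis
      then have "(inv p k, inv p l) \<in> offdiag N"
        using z p(2)[of "inv p k"] p(2)[of "inv p l"] inv by (simp add: offdiag_def)
      ultimately show "z \<in> map_prod p p ` offdiag N" by blast
    qed (use p in \<open>auto simp: offdiag_def inj_def\<close>)
  qed
  from sum.reindex_bij_betw[OF this, of "\<lambda>(k, l). F k l"] show ?thesis
    by (simp add: case_prod_unfold)
qed

lemma ex_sorting_permutation:
  fixes x :: "nat \<Rightarrow> 'a :: linorder"
  obtains p where "p permutes {..<N}" "\<And>i j. i \<le> j \<Longrightarrow> j < N \<Longrightarrow> x (p i) \<le> x (p j)"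
proof -
  let ?xs = "map x [0..<N]"
  obtain p where p: "p permutes {..<length ?xs}" "permute_list p ?xs = sort ?xs"
    by (rule mset_eq_permutation[of "sort ?xs" ?xs]) auto
  have p': "p permutes {..<N}" using p by simp
  have "sort ?xs ! i = x (p i)" if "i < N" for i
    using that p permutes_in_image[OF p', of i] by (simp flip: p(2) add: permute_list_nth)
  then have "x (p i) \<le> x (p j)" if "i \<le> j" "j < N" for i j
    using that sorted_nth_mono[OF sorted_sort[of ?xs], of i j] by simp
  with p' show ?thesis by (rule that)
qed

text \<open>Relabelling the points permutes the ordered pairs and leaves the sum unchanged, so the
  points may be taken in increasing order. The gap argument for criterion (a) relies on this
  order.\<close>

lemma equispacing_sortedI:
  assumes "\<And>x. (\<And>k. k < N \<Longrightarrow> x k \<in> {0..<1}) \<Longrightarrow> (\<And>i j. i \<le> j \<Longrightarrow> j < N \<Longrightarrow> x i \<le> x j) \<Longrightarrow>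
      (\<Sum>(k, l)\<in>offdiag N. g (real k / real N - real l / real N))
      \<le> (\<Sum>(k, l)\<in>offdiag N. g (x k - x l))"
  shows "equispacing N g"
  unfolding equispacing_def
proof (intro allI impI)
  fix x :: "nat \<Rightarrow> real" assume x: "\<forall>k<N. x k \<in> {0..<1}"
  obtain p where p: "p permutes {..<N}" "\<And>i j. i \<le> j \<Longrightarrow> j < N \<Longrightarrow> x (p i) \<le> x (p j)"
    using ex_sorting_permutation[of N x] by blast
  have "(\<Sum>(k, l)\<in>offdiag N. g (real k / real N - real l / real N))
      \<le> (\<Sum>(k, l)\<in>offdiag N. g (x (p k) - x (p l)))"
    using assms[of "x \<circ> p"] x p permutes_in_image[OF p(1)] by auto
  also have "\<dots> = (\<Sum>(k, l)\<in>offdiag N. g (x k - x l))"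
    by (rule sum_offdiag_permute[OF p(1), of "\<lambda>a b. g (x a - x b)"])
  finally show "(\<Sum>(k, l)\<in>offdiag N. g (real k / real N - real l / real N))
      \<le> (\<Sum>(k, l)\<in>offdiag N. g (x k - x l))" .
qed

lemma sum_ereal_offdiag:
  "(\<Sum>(k, l)\<in>offdiag N. ereal (b k l)) = ereal (\<Sum>(k, l)\<in>offdiag N. b k l)"
  by (simp add: case_prod_unfold flip: sum_ereal)

text \<open>Modulo 1 and up to sign, \<open>k/5 - l/5\<close> is 1/5 for ten ordered pairs and 2/5
  for the other ten.\<close>

lemma sum_offdiag_lattice:
  fixes g :: "real \<Rightarrow> ereal"
  assumes "\<And>t. g (- t) = g t" "\<And>t. g (t + 1) = g t"
    and "g (1/5) = ereal a" "g (2/5) = ereal b"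
  shows "(\<Sum>(k, l)\<in>offdiag 5. g (real k / real 5 - real l / real 5)) = ereal (10 * (a + b))"
proof -
  have "g (3/5) = ereal b" "g (4/5) = ereal a"
    using assms(1)[of "2/5"] assms(2)[of "-2/5"] assms(1)[of "1/5"] assms(2)[of "-1/5"] assms(3,4)
    by simp_all
  with assms(3,4) have "g (-(1/5)) = ereal a" "g (-(2/5)) = ereal b"
    "g (-(3/5)) = ereal b" "g (-(4/5)) = ereal a" "g (3/5) = ereal b" "g (4/5) = ereal a"
    unfolding assms(1) by auto
  with assms(3,4) show ?thesis
    by (simp add: sum_offdiag lessThan_5 algebra_simps)
qed

section \<open>Inequalities for cosine sums and the logarithm; cosines of the regular
  pentagon\<close>

text \<open>Adding the diagonal, which contributes \<open>N\<close>, turns the sum into the squared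
  modulus of the sum of exp(i \<theta>_k), which is nonnegative.\<close>

lemma neg_card_le_sum_cos:
  fixes \<theta> :: "nat \<Rightarrow> real"
  shows "- real N \<le> (\<Sum>(k, l)\<in>offdiag N. cos (\<theta> k - \<theta> l))"
proof -
  have "(\<Sum>(k, l)\<in>offdiag N. cos (\<theta> k - \<theta> l))
      = (\<Sum>k<N. \<Sum>l<N. cos (\<theta> k - \<theta> l) - (if k = l then 1 else 0))"
    unfolding sum_offdiag by (intro sum.cong) auto
  also have "\<dots> = (\<Sum>k<N. \<Sum>l<N. cos (\<theta> k) * cos (\<theta> l)) + (\<Sum>k<N. \<Sum>l<N. sin (\<theta> k) * sin (\<theta> l)) - real N"
    by (simp add: sum_subtractf cos_diff sum.distrib)
  also have "\<dots> = (\<Sum>k<N. cos (\<theta> k))\<^sup>2 + (\<Sum>k<N. sin (\<theta> k))\<^sup>2 - real N"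
    by (simp add: sum_product power2_eq_square)
  finally show ?thesis by simp
qed

text \<open>This is ln w \<le> w - 1 at w = z/c, multiplied by c. Equality holds at z = c, the value
  of every summand on the lattice.\<close>

lemma ln_tangent_le:
  fixes c z :: real
  assumes "0 < c" "0 < z"
  shows "c * (1 + ln z - ln c) \<le> z"
proof -
  have "ln z - ln c = ln (z / c)" using assms by (simp add: ln_div)
  also have "\<dots> \<le> z / c - 1" using assms by (intro ln_le_minus_one) simp
  finally have "c * (1 + ln z - ln c) \<le> c * (z / c)"
    using assms by (intro mult_left_mono) auto
  with assms show ?thesis by simp
qed

lemma cos_2_pi_5:
  "4 * (cos (2 * pi / 5))\<^sup>2 + 2 * cos (2 * pi / 5) = 1"
  "cos (4 * pi / 5) = - 1/2 - cos (2 * pi / 5)"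
  "cos (4 * pi / 5) \<le> - 1/2"
proof -
  let ?c = "cos (2 * pi / 5)"
  have c2: "cos (4 * pi / 5) = 2 * ?c\<^sup>2 - 1"
    using cos_double_cos[of "2 * pi / 5"] by simp
  \<comment> \<open>Since 4 pi/5 and 6 pi/5 add up to 2 pi, the double and triple angle formulas
    give the same number. The resulting cubic in \<open>?c\<close> has the spurious root 1, which is
    divided out.\<close>
  have "cos (4 * pi / 5) = cos (3 * (2 * pi / 5))"
    using cos_2pi_minus[of "4 * pi / 5"] by (simp add: field_simps)
  also have "\<dots> = 4 * ?c ^ 3 - 3 * ?c" by (rule cos_treble_cos)
  finally have "(?c - 1) * (4 * ?c\<^sup>2 + 2 * ?c - 1) = 0"
    unfolding c2 by (simp add: algebra_simps power2_eq_square power3_eq_cube)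
  moreover have "?c < 1"
    using cos_monotone_0_pi[of 0 "2 * pi / 5"] by simp
  ultimately show c: "4 * ?c\<^sup>2 + 2 * ?c = 1" by simp
  then show c': "cos (4 * pi / 5) = - 1/2 - ?c" using c2 by simp
  have "0 \<le> ?c" by (rule cos_ge_zero) (use pi_gt_zero in linarith)+
  with c' show "cos (4 * pi / 5) \<le> - 1/2" by simp
qed

section \<open>Divided differences and Hermite interpolation of absolutely monotone
  functions\<close>

text \<open>The divided difference is q(s) = integral over t in [0,1] of u'(c + t(s - c)).
  Differentiating k times under the integral sign brings out t^k u^(k+1), so all derivatives of q,
  and q itself, inherit nonnegativity. The integral form also covers s = c.\<close>

lemma absolutely_monotone_quotient:
  assumes "absolutely_monotone u" and c: "c \<in> {-1..<1}"
  obtains q where "absolutely_monotone q" "\<And>s. s \<in> {-1..<1} \<Longrightarrow> 0 \<le> q s"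
    "\<And>s. s \<in> {-1..<1} \<Longrightarrow> u s = u c + (s - c) * q s"
proof -
  let ?I = "{-1..<1} :: real set"
  obtain D where D0: "\<And>s. s \<in> ?I \<Longrightarrow> D 0 s = u s"
    and D: "\<And>k s. s \<in> ?I \<Longrightarrow> (D k has_real_derivative D (Suc k) s) (at s within ?I)"
    and D_pos: "\<And>k s. 1 \<le> k \<Longrightarrow> s \<in> {-1<..<1} \<Longrightarrow> 0 \<le> D k s"
    using assms(1) unfolding absolutely_monotone_def by blast
  have D_cont: "continuous_on ?I (D k)" for k
    by (rule DERIV_continuous_on) (rule D)
  \<comment> \<open>The definition gives the sign on the open interval; continuity carries it to the
    endpoint -1, which the segments from \<open>c\<close> to \<open>s\<close> may touch.\<close>
  have D_nonneg: "0 \<le> D k s" if "1 \<le> k" "s \<in> ?I" for k s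
  proof (cases "s = -1")
    case True
    have "(D k \<longlongrightarrow> D k (-1)) (at (-1) within ?I)"
      using D_cont[of k] by (simp add: continuous_on)
    then have "(D k \<longlongrightarrow> D k (-1)) (at (-1) within {-1<..<1})"
      by (rule tendsto_within_subset) auto
    moreover have "eventually (\<lambda>s. 0 \<le> D k s) (at (-1) within {-1<..<1})"
      using D_pos[OF that(1)] by (auto simp: eventually_at_filter)
    moreover have "at (-1::real) within {-1<..<1} \<noteq> bot"
      by (simp add: at_within_eq_bot_iff)
    ultimately show ?thesis
      using True tendsto_lowerbound by blast
  qed (use that D_pos in auto)
  have seg: "c + t * (s - c) \<in> ?I" if "s \<in> ?I" "t \<in> {0..1}" for s t
  proof -
    have "(1 - t) *\<^sub>R c + t *\<^sub>R s \<in> ?I"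
      using that c by (intro convexD_alt) auto
    then show ?thesis by (simp add: algebra_simps)
  qed
  \<comment> \<open>\<open>Q k\<close> is the candidate for the k-th derivative of the quotient
    \<open>Q 0\<close>.\<close>
  define Q where "Q k s = integral (cbox 0 1) (\<lambda>t. t ^ k * D (Suc k) (c + t * (s - c)))" for k s
  have cont: "continuous_on {0..1} (\<lambda>t. t ^ k * D j (c + t * (s - c)))" if "s \<in> ?I" for k j s
    by (intro continuous_intros continuous_on_compose2[OF D_cont]) (use seg that in auto)
  have Q_deriv: "(Q k has_real_derivative Q (Suc k) s) (at s within ?I)" if "s \<in> ?I" for k s
    unfolding Q_def
  proof (rule leibniz_rule_field_derivative)
    show "((\<lambda>x. t ^ k * D (Suc k) (c + t * (x - c))) has_real_derivative
        t ^ Suc k * D (Suc (Suc k)) (c + t * (x - c))) (at x within ?I)"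
      if "x \<in> ?I" "t \<in> cbox 0 1" for x t
    proof -
      have "((\<lambda>x. c + t * (x - c)) has_real_derivative t) (at x within ?I)"
        by (auto intro!: derivative_eq_intros)
      moreover have "(D (Suc k) has_real_derivative D (Suc (Suc k)) (c + t * (x - c)))
          (at (c + t * (x - c)) within (\<lambda>x. c + t * (x - c)) ` ?I)"
        by (rule DERIV_subset[OF D]) (use seg that in auto)
      ultimately have "((\<lambda>x. D (Suc k) (c + t * (x - c))) has_real_derivative
          D (Suc (Suc k)) (c + t * (x - c)) * t) (at x within ?I)"
        by (rule DERIV_image_chain[unfolded o_def, rotated])
      from DERIV_cmult[OF this, of "t ^ k"] show ?thesis
        by (simp add: mult_ac)
    qed
    show "(\<lambda>t. t ^ k * D (Suc k) (c + t * (x - c))) integrable_on cbox 0 1" if "x \<in> ?I" for x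
      using cont[OF that] by (intro integrable_continuous) simp
    show "continuous_on (?I \<times> cbox 0 1)
        (\<lambda>(x, t). t ^ Suc k * D (Suc (Suc k)) (c + t * (x - c)))"
      unfolding case_prod_unfold
      by (intro continuous_intros continuous_on_compose2[OF D_cont]) (use seg in auto)
  qed (use that in auto)
  have Q_nonneg: "0 \<le> Q k s" if "s \<in> ?I" for k s
    unfolding Q_def using cont[OF that] seg[OF that] D_nonneg
    by (intro integral_nonneg integrable_continuous) auto
  have "absolutely_monotone (Q 0)"
    unfolding absolutely_monotone_def using Q_deriv Q_nonneg
    by (intro exI[of _ Q]) auto
  moreover have "u s = u c + (s - c) * Q 0 s" if s: "s \<in> ?I" for s
  proof -
    have "((\<lambda>t. (s - c) * D 1 (c + t * (s - c))) has_integral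
        D 0 (c + 1 * (s - c)) - D 0 (c + 0 * (s - c))) {0..1}"
    proof (rule fundamental_theorem_of_calculus)
      fix t :: real assume t: "t \<in> {0..1}"
      have "((\<lambda>t. c + t * (s - c)) has_real_derivative (s - c)) (at t within {0..1})"
        by (auto intro!: derivative_eq_intros)
      moreover have "(D 0 has_real_derivative D 1 (c + t * (s - c)))
          (at (c + t * (s - c)) within (\<lambda>t. c + t * (s - c)) ` {0..1})"
        using D[of _ 0] by (intro DERIV_subset[OF D[of _ 0, folded One_nat_def]]) (use seg s t in auto)
      ultimately have "((\<lambda>t. D 0 (c + t * (s - c))) has_real_derivative
          D 1 (c + t * (s - c)) * (s - c)) (at t within {0..1})"
        by (rule DERIV_image_chain[unfolded o_def, rotated])
      then show "((\<lambda>t. D 0 (c + t * (s - c))) has_vector_derivative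
          (s - c) * D 1 (c + t * (s - c))) (at t within {0..1})"
        by (simp add: has_real_derivative_iff_has_vector_derivative mult.commute)
    qed simp
    from integral_unique[OF this] show ?thesis
      using s c by (simp add: Q_def D0)
  qed
  ultimately show ?thesis using Q_nonneg that by blast
qed

text \<open>The Hermite interpolant at the double nodes \<open>a\<close> and \<open>b\<close>, in Newton form.\<close>
lemma absolutely_monotone_Hermite_bound:
  assumes "absolutely_monotone u" "a \<in> {-1..<1}" "b \<in> {-1..<1}"
  obtains \<alpha> \<beta> \<gamma> where "0 \<le> \<alpha>" "0 \<le> \<beta>" "0 \<le> \<gamma>"
    "u b = u a + \<alpha> * (b - a) + \<beta> * (b - a)\<^sup>2"
    "\<And>s. s \<in> {-1..<1} \<Longrightarrow>
       u a + \<alpha> * (s - a) + \<beta> * (s - a)\<^sup>2 + \<gamma> * (s - a)\<^sup>2 * (s - b) \<le> u s"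
proof -
  \<comment> \<open>Successive divided differences at the nodes \<open>a\<close>, \<open>a\<close>,
    \<open>b\<close>, \<open>b\<close>. The interpolation error is (s - a)^2 (s - b)^2
    \<open>q4 s\<close>, hence nonnegative.\<close>
  obtain q1 where q1: "absolutely_monotone q1" "\<And>s. s \<in> {-1..<1} \<Longrightarrow> 0 \<le> q1 s"
    "\<And>s. s \<in> {-1..<1} \<Longrightarrow> u s = u a + (s - a) * q1 s"
    using absolutely_monotone_quotient[OF assms(1,2)] by blast
  obtain q2 where q2: "absolutely_monotone q2" "\<And>s. s \<in> {-1..<1} \<Longrightarrow> 0 \<le> q2 s"
    "\<And>s. s \<in> {-1..<1} \<Longrightarrow> q1 s = q1 a + (s - a) * q2 s"
    using absolutely_monotone_quotient[OF q1(1) assms(2)] by blast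
  obtain q3 where q3: "absolutely_monotone q3" "\<And>s. s \<in> {-1..<1} \<Longrightarrow> 0 \<le> q3 s"
    "\<And>s. s \<in> {-1..<1} \<Longrightarrow> q2 s = q2 b + (s - b) * q3 s"
    using absolutely_monotone_quotient[OF q2(1) assms(3)] by blast
  obtain q4 where q4: "absolutely_monotone q4" "\<And>s. s \<in> {-1..<1} \<Longrightarrow> 0 \<le> q4 s"
    "\<And>s. s \<in> {-1..<1} \<Longrightarrow> q3 s = q3 b + (s - b) * q4 s"
    using absolutely_monotone_quotient[OF q3(1) assms(3)] by blast
  show ?thesis
  proof (rule that)
    show "0 \<le> q1 a" "0 \<le> q2 b" "0 \<le> q3 b" 
      using assms q1(2)[of a] q2(2)[of b] q3(2)[of b] by simp_all
    show "u b = u a + q1 a * (b - a) + q2 b * (b - a)\<^sup>2"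
      unfolding q1(3)[OF assms(3)] q2(3)[OF assms(3)] by (simp add: algebra_simps power2_eq_square)
    show "u a + q1 a * (s - a) + q2 b * (s - a)\<^sup>2 + q3 b * (s - a)\<^sup>2 * (s - b) \<le> u s"
      if s: "s \<in> {-1..<1}" for s
    proof -
      have "u s = u a + q1 a * (s - a) + q2 b * (s - a)\<^sup>2 + q3 b * (s - a)\<^sup>2 * (s - b)
          + (s - a)\<^sup>2 * (s - b)\<^sup>2 * q4 s"
        unfolding q1(3)[OF s] q2(3)[OF s] q3(3)[OF s] q4(3)[OF s]
        by (simp add: algebra_simps power2_eq_square)
      with q4(2)[OF s] show ?thesis by simp
    qed
  qed
qed

section \<open>Cubic polynomials in the cosine of differences\<close>

text \<open>With nonnegative coefficients it suffices to bound the power sums of the cosines from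
  below. The bounds -5, 15/2, -5 for the powers 1, 2, 3 come from the cosine sums of frequencies 1,
  2, 3 and are exactly the values on the regular pentagon. The coefficient \<open>c0\<close> may
  have any sign, as the number of pairs is fixed.\<close>

lemma cubic_sum_cos_ge:
  fixes x :: "nat \<Rightarrow> real" and c0 c1 c2 c3 :: real
  assumes "0 \<le> c1" "0 \<le> c2" "0 \<le> c3"
  defines "P \<equiv> \<lambda>s. c0 + c1 * s + c2 * s\<^sup>2 + c3 * s ^ 3"
  shows "10 * (P (cos (2 * pi / 5)) + P (cos (4 * pi / 5)))
    \<le> (\<Sum>(k, l)\<in>offdiag 5. P (cos (2 * pi * (x k - x l))))"
proof -
  define S where "S j = (\<Sum>(k, l)\<in>offdiag 5. cos (2 * pi * (x k - x l)) ^ j)" for j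
  have cos_j: "- 5 \<le> (\<Sum>(k, l)\<in>offdiag 5. cos (j * (2 * pi * (x k - x l))))" for j
    using neg_card_le_sum_cos[of 5 "\<lambda>k. j * (2 * pi * x k)"] by (simp add: algebra_simps)
  have S1: "- 5 \<le> S 1"
    using cos_j[of 1] by (simp add: S_def)
  have "- 5 \<le> (\<Sum>(k, l)\<in>offdiag 5. 2 * cos (2 * pi * (x k - x l)) ^ 2 - 1)"
    using cos_j[of 2] by (simp only: cos_double_cos)
  also have "\<dots> = 2 * S 2 - 20"
    by (simp add: S_def case_prod_unfold sum_subtractf sum_distrib_left card_offdiag_5)
  finally have S2: "15/2 \<le> S 2" by simp
  have "- 5 \<le> (\<Sum>(k, l)\<in>offdiag 5. 4 * cos (2 * pi * (x k - x l)) ^ 3 - 3 * cos (2 * pi * (x k - x l)))"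
    using cos_j[of 3] by (simp only: cos_treble_cos)
  also have "\<dots> = 4 * S 3 - 3 * S 1"
    by (simp add: S_def case_prod_unfold sum_subtractf sum_distrib_left)
  finally have S3: "- 5 \<le> S 3" using S1 by simp
  \<comment> \<open>It remains to evaluate the pentagon side, reducing powers of \<open>?c\<close>
    by its quadratic equation.\<close>
  let ?c = "cos (2 * pi / 5)"
  have sq: "?c\<^sup>2 = 1/4 - ?c / 2" using cos_2_pi_5(1) by linarith
  have cube: "?c ^ 3 = ?c / 2 - 1/8"
  proof -
    have "?c ^ 3 = ?c * ?c\<^sup>2" by (simp add: power3_eq_cube power2_eq_square)
    also have "\<dots> = ?c * (1/4 - ?c / 2)" by (simp only: sq)
    also have "\<dots> = ?c / 4 - ?c\<^sup>2 / 2" by (simp add: algebra_simps power2_eq_square)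
    finally show ?thesis using sq by linarith
  qed
  have "P ?c + P (cos (4 * pi / 5)) = 2 * c0 - c1 / 2 + c2 * (?c\<^sup>2 + (- 1/2 - ?c)\<^sup>2)
      + c3 * (?c ^ 3 + (- 1/2 - ?c) ^ 3)"
    unfolding P_def cos_2_pi_5(2) by (simp add: algebra_simps)
  also have "?c\<^sup>2 + (- 1/2 - ?c)\<^sup>2 = 2 * ?c\<^sup>2 + ?c + 1/4"
    by (simp add: algebra_simps power2_eq_square)
  also have "\<dots> = 3/4" using sq by linarith
  also have "?c ^ 3 + (- 1/2 - ?c) ^ 3 = - (3/2) * ?c\<^sup>2 - 3/4 * ?c - 1/8"
    by (simp add: algebra_simps power2_eq_square power3_eq_cube)
  also have "\<dots> = - 1/2" using sq by linarith
  finally have "10 * (P ?c + P (cos (4 * pi / 5))) = 20 * c0 + c1 * (-5) + c2 * (15/2) + c3 * (-5)"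
    by simp
  also have "\<dots> \<le> 20 * c0 + c1 * S 1 + c2 * S 2 + c3 * S 3"
    using assms(1-3) S1 S2 S3 by (intro add_mono mult_left_mono) auto
  also have "\<dots> = (\<Sum>(k, l)\<in>offdiag 5. P (cos (2 * pi * (x k - x l))))"
    by (simp add: P_def S_def case_prod_unfold sum.distrib sum_distrib_left card_offdiag_5)
  finally show ?thesis .
qed

section \<open>Positive potentials and their logarithms\<close>

locale positive_potential =
  fixes f :: "real \<Rightarrow> ereal"
  assumes potential: "potential f"
    and pos: "t \<notin> \<int> \<Longrightarrow> 0 < f t" and finite: "t \<notin> \<int> \<Longrightarrow> f t < \<infinity>"
begin

text \<open>A real-valued logarithm, so that convexity and calculus apply. Where \<open>f\<close> is
  infinite its value is a mere convention.\<close>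

definition L :: "real \<Rightarrow> real" where
  "L t = ln (real_of_ereal (f t))"

lemma f_minus: "f (- t) = f t" and f_plus_1: "f (t + 1) = f t"
  using potential unfolding potential_def by auto

lemma f_abs: "f \<bar>t\<bar> = f t"
  using f_minus[of t] by (simp add: abs_if)

lemma f_1_minus: "f (1 - t) = f t"
  using f_plus_1[of "- t"] f_minus[of t] by (simp add: add.commute)

lemma not_Ints: "t \<noteq> 0 \<Longrightarrow> \<bar>t\<bar> < 1 \<Longrightarrow> t \<notin> \<int>" for t :: real
  using Ints_nonzero_abs_less1 by blast

lemma f_0: "f 0 = \<infinity> \<or> isCont f 0 \<and> 0 < f 0 \<and> f 0 < \<infinity>"
  using potential unfolding potential_def
  by (auto simp: continuous_on_eq_continuous_at)

text \<open>Differences of coordinates in [0,1) lie in (-1,1), where 0 is the only integer;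
  positivity there follows from both alternatives for \<open>f 0\<close>.\<close>

lemma f_pos: "\<bar>t\<bar> < 1 \<Longrightarrow> 0 < f t"
  using f_0 pos[of t] not_Ints[of t] by (cases "t = 0") auto

lemma f_finite:
  assumes "t \<notin> \<int>"
  obtains r where "f t = ereal r" "0 < r" "L t = ln r"
  using pos[OF assms] finite[OF assms] that unfolding L_def by (cases "f t") auto

lemma ln_ext_f: "t \<notin> \<int> \<Longrightarrow> ln_ext (f t) = ereal (L t)"
  by (erule f_finite) (simp add: ln_ext_def)

text \<open>Coinciding coordinates require lower bounds at 0 too. In the singular case the right
  side is \<infinity>; otherwise the bound passes to the limit by continuity of
  \<open>f\<close>.\<close>

lemma ln_ext_f_0_ge:
  assumes "(b \<longlongrightarrow> B) (at_right 0)" "eventually (\<lambda>t. b t \<le> L t) (at_right 0)"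
  shows "ereal B \<le> ln_ext (f 0)"
  using f_0
proof
  assume "isCont f 0 \<and> 0 < f 0 \<and> f 0 < \<infinity>"
  then obtain r where r: "f 0 = ereal r" "0 < r" and "isCont f 0"
    by (cases "f 0") auto
  then have "(f \<longlongrightarrow> ereal r) (at_right 0)"
    by (simp add: isCont_def filterlim_at_split)
  then have "(L \<longlongrightarrow> ln r) (at_right 0)"
    using r unfolding L_def by (intro tendsto_intros lim_real_of_ereal) auto
  with assms have "B \<le> ln r"
    using tendsto_le[OF trivial_limit_at_right_real] by blast
  with r show ?thesis by (simp add: ln_ext_def)
qed (simp add: ln_ext_def)

lemma sum_ln_ext_lattice:
  "(\<Sum>(k, l)\<in>offdiag 5. ln_ext (f (real k / real 5 - real l / real 5)))
    = ereal (10 * (L (1/5) + L (2/5)))"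
  by (rule sum_offdiag_lattice) (simp_all add: f_minus f_plus_1 ln_ext_f not_Ints)

text \<open>The equispacing inequality brought down to real numbers. The condition is finiteness of
  \<open>f\<close> at the differences, not distinctness of the points: for a continuous potential
  coordinates may coincide.\<close>

lemma sum_L_ge:
  assumes "equispacing 5 (\<lambda>t. ln_ext (f t))" "\<And>k. k < 5 \<Longrightarrow> x k \<in> {0..<1}"
    and "\<And>k l. (k, l) \<in> offdiag 5 \<Longrightarrow> f (x k - x l) \<noteq> \<infinity>"
  shows "10 * (L (1/5) + L (2/5)) \<le> (\<Sum>(k, l)\<in>offdiag 5. L (x k - x l))"
proof -
  have "ln_ext (f (x k - x l)) = ereal (L (x k - x l))" if "(k, l) \<in> offdiag 5" for k l
  proof -
    have "0 < f (x k - x l)"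
      using that assms(2)[of k] assms(2)[of l] by (intro f_pos) (auto simp: offdiag_def)
    with assms(3)[OF that] show ?thesis
      by (cases "f (x k - x l)") (auto simp: L_def ln_ext_def)
  qed
  then have "(\<Sum>(k, l)\<in>offdiag 5. ln_ext (f (x k - x l))) = (\<Sum>(k, l)\<in>offdiag 5. ereal (L (x k - x l)))"
    by (intro sum.cong) auto
  moreover have "(\<Sum>(k, l)\<in>offdiag 5. ln_ext (f (real k / real 5 - real l / real 5)))
      \<le> (\<Sum>(k, l)\<in>offdiag 5. ln_ext (f (x k - x l)))"
    using assms(1,2) unfolding equispacing_def by blast
  ultimately show ?thesis
    unfolding sum_ln_ext_lattice by (simp add: sum_ereal_offdiag)
qed

section \<open>From equispacing of the logarithm to minimality of the energy\<close>

text \<open>The second coordinate is three times the first modulo 1, and multiplication by 3 swaps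
  the classes of \<plusminus>1 and \<plusminus>2 modulo 5. Thus each pair has one factor
  \<open>f (1/5)\<close> and one factor \<open>f (2/5)\<close>.\<close>

lemma tensor_energy_Fibonacci5: "tensor_energy f Fibonacci5 = 20 * (f (1/5) * f (2/5))"
proof -
  obtain a where a: "f (1/5) = ereal a" by (rule f_finite[OF not_Ints[of "1/5"]]) auto
  obtain b where b: "f (2/5) = ereal b" by (rule f_finite[OF not_Ints[of "2/5"]]) auto
  have ab: "f (3/5) = ereal b" "f (4/5) = ereal a"
    using f_1_minus[of "2/5"] f_1_minus[of "1/5"] a b by simp_all
  have "f (-(1/5)) = ereal a" "f (-(2/5)) = ereal b" "f (-(3/5)) = ereal b" "f (-(4/5)) = ereal a"
    using a b ab by (simp_all only: f_minus)
  with a b ab show ?thesis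
    by (simp add: tensor_energy_def Fibonacci5_def sum_offdiag lessThan_5 mult.commute)
qed

theorem equispacing_imp_energy_minimizer:
  assumes eq: "equispacing 5 (\<lambda>t. ln_ext (f t))"
  shows "energy_minimizer f 5 Fibonacci5"
  unfolding energy_minimizer_def
proof (intro conjI allI impI)
  show "torus_configuration 5 Fibonacci5"
    by (simp add: torus_configuration_def Fibonacci5_def)
next
  fix Y assume Y: "torus_configuration 5 Y"
  define x y where "x k = fst (Y ! k)" and "y k = snd (Y ! k)" for k
  have xy: "x k \<in> {0..<1} \<and> y k \<in> {0..<1}" if "k < 5" for k
  proof -
    have "Y ! k \<in> set Y" using Y that by (simp add: torus_configuration_def)
    then have "Y ! k \<in> {0..<1} \<times> {0..<1}"
      using Y unfolding torus_configuration_def by blast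
    then show ?thesis by (auto simp: x_def y_def)
  qed
  have f_pos': "0 < f (x k - x l)" "0 < f (y k - y l)" if "(k, l) \<in> offdiag 5" for k l
    using that xy[of k] xy[of l] by (auto simp: offdiag_def intro!: f_pos)
  have energy: "tensor_energy f Y = (\<Sum>(k, l)\<in>offdiag 5. f (x k - x l) * f (y k - y l))"
    using Y by (simp add: tensor_energy_def torus_configuration_def x_def y_def)
  show "tensor_energy f Fibonacci5 \<le> tensor_energy f Y"
  \<comment> \<open>If one factor is infinite, positivity of the other makes the product, and with
    it the energy, infinite. Otherwise all factors are positive reals.\<close>
  proof (cases "\<exists>k l. (k, l) \<in> offdiag 5 \<and> (f (x k - x l) = \<infinity> \<or> f (y k - y l) = \<infinity>)")
    case True
    then obtain k l where kl: "(k, l) \<in> offdiag 5" "f (x k - x l) = \<infinity> \<or> f (y k - y l) = \<infinity>"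
      by blast
    then have "f (x k - x l) * f (y k - y l) = \<infinity>"
      using f_pos'[OF kl(1)] by (auto simp: ereal_mult_eq_PInfty)
    with kl have "tensor_energy f Y = \<infinity>"
      unfolding energy sum_Pinfty by (intro conjI bexI[of _ "(k, l)"]) simp_all
    then show ?thesis by simp
  next
    case False
    define p q where "p k l = real_of_ereal (f (x k - x l))" and "q k l = real_of_ereal (f (y k - y l))" for k l
    have pq: "f (x k - x l) = ereal (p k l)" "0 < p k l" "f (y k - y l) = ereal (q k l)" "0 < q k l"
      if "(k, l) \<in> offdiag 5" for k l
      using that f_pos'[OF that] False unfolding p_def q_def
      by (cases "f (x k - x l)"; cases "f (y k - y l)"; auto)+
    obtain a where a: "f (1/5) = ereal a" "0 < a" "L (1/5) = ln a"
      by (rule f_finite[OF not_Ints[of "1/5"]]) auto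
    obtain b where b: "f (2/5) = ereal b" "0 < b" "L (2/5) = ln b"
      by (rule f_finite[OF not_Ints[of "2/5"]]) auto
    have sums: "10 * (ln a + ln b) \<le> (\<Sum>(k, l)\<in>offdiag 5. ln (p k l))"
      "10 * (ln a + ln b) \<le> (\<Sum>(k, l)\<in>offdiag 5. ln (q k l))"
      using sum_L_ge[OF eq, of x] sum_L_ge[OF eq, of y] xy False
      unfolding a b by (auto simp: L_def p_def q_def)
    define m where "m = ln a + ln b"
    \<comment> \<open>Each coordinate sum is at least 10 \<open>m\<close>, so the bracket on the
      right is at least 20.\<close>
    have "20 * (a * b) \<le> (a * b) * (20 * (1 - m) + (\<Sum>(k, l)\<in>offdiag 5. ln (p k l)) + (\<Sum>(k, l)\<in>offdiag 5. ln (q k l)))"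
      using mult_left_mono[OF add_mono[OF sums], of "a * b"] a b by (simp add: m_def algebra_simps)
    also have "\<dots> = (\<Sum>(k, l)\<in>offdiag 5. (a * b) * (1 + (ln (p k l) + ln (q k l)) - m))"
      by (simp add: case_prod_unfold sum.distrib sum_subtractf card_offdiag_5 flip: sum_distrib_left)
    \<comment> \<open>The tangent inequality for each pair, with c = \<open>a * b\<close>.\<close>
    also have "\<dots> \<le> (\<Sum>(k, l)\<in>offdiag 5. p k l * q k l)"
    proof (rule sum_mono, clarify)
      fix k l assume "(k, l) \<in> offdiag 5"
      then show "a * b * (1 + (ln (p k l) + ln (q k l)) - m) \<le> p k l * q k l"
        using ln_tangent_le[of "a * b" "p k l * q k l"] pq a b by (simp add: ln_mult_pos m_def)
    qed
    finally have "ereal (20 * (a * b)) \<le> (\<Sum>(k, l)\<in>offdiag 5. ereal (p k l * q k l))"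
      by (simp add: sum_ereal_offdiag)
    also have "\<dots> = tensor_energy f Y"
      unfolding energy by (intro sum.cong) (auto simp: pq)
    finally show ?thesis
      by (simp add: tensor_energy_Fibonacci5 a b)
  qed
qed

section \<open>Criterion (a): decreasing, logarithmically convex potentials\<close>

text \<open>Since \<open>m \<le> 0\<close>, the support line stays below the reflected branch on \<open>[1/2,1]\<close> as well.\<close>
lemma support_line:
  assumes anti: "antimono_on {0<..1/2} f" and conv: "convex_on {0<..1/2} L" and p: "p \<in> {0<..<1/2}"
  obtains m where "\<And>t. t \<in> {0..1} \<Longrightarrow> ereal (L p + m * (t - p)) \<le> ln_ext (f t)"
proof -
  have "p \<in> interior {0<..1/2}"
    using p interior_maximal[of "{0<..<1/2}" "{0<..1/2::real}"] by auto
  then obtain m where m: "\<And>t. t \<in> {0<..1/2} \<Longrightarrow> L p + m * (t - p) \<le> L t"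
    using convex_le_Inf_differential[OF conv] by meson
  \<comment> \<open>Monotonicity of \<open>f\<close> gives the sign of the slope: the support line
    at 1/2 is at most \<open>L (1/2)\<close>, hence at most \<open>L p\<close>.\<close>
  have "L (1/2) \<le> L p"
  proof -
    obtain r where r: "f p = ereal r" "0 < r" "L p = ln r"
      using p by (auto intro: f_finite[OF not_Ints[of p]])
    obtain s where s: "f (1/2) = ereal s" "0 < s" "L (1/2) = ln s"
      by (auto intro: f_finite[OF not_Ints[of "1/2"]])
    have "f (1/2) \<le> f p" using monotone_onD[OF anti, of p "1/2"] p by simp
    with r s show ?thesis by simp
  qed
  with m[of "1/2"] have "m * (1/2 - p) \<le> 0" by simp
  then have "m \<le> 0" using p by (simp add: mult_le_0_iff)
  have at_0: "ereal (L p + m * (0 - p)) \<le> ln_ext (f 0)"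
  proof (rule ln_ext_f_0_ge)
    show "((\<lambda>t. L p + m * (t - p)) \<longlongrightarrow> L p + m * (0 - p)) (at_right 0)"
      by (intro tendsto_intros)
    show "eventually (\<lambda>t. L p + m * (t - p) \<le> L t) (at_right 0)"
      using eventually_at_right_real[of 0 "1/2"] by (rule eventually_mono) (use m in auto)
  qed
  have left: "ereal (L p + m * (t - p)) \<le> ln_ext (f t)" if "t \<in> {0..1/2}" for t
    using that at_0 m[of t] by (cases "t = 0") (auto simp: ln_ext_f not_Ints)
  have "ereal (L p + m * (t - p)) \<le> ln_ext (f t)" if "t \<in> {0..1}" for t
  proof (cases "t \<le> 1/2")
    case False
    have "m * (t - p) \<le> m * (1 - t - p)"
      using \<open>m \<le> 0\<close> False by (intro mult_left_mono_neg) auto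
    with left[of "1 - t"] that False show ?thesis
      by (simp add: f_1_minus order.trans[rotated])
  qed (use that left in auto)
  with that show ?thesis by blast
qed

theorem equispacing_convex:
  assumes "antimono_on {0<..1/2} f" "convex_on {0<..1/2} L"
  shows "equispacing 5 (\<lambda>t. ln_ext (f t))"
proof (rule equispacing_sortedI)
  fix x :: "nat \<Rightarrow> real"
  assume x: "\<And>k. k < 5 \<Longrightarrow> x k \<in> {0..<1}" and sorted: "\<And>i j. i \<le> j \<Longrightarrow> j < 5 \<Longrightarrow> x i \<le> x j"
  obtain m where m: "\<And>t. t \<in> {0..1} \<Longrightarrow> ereal (L (1/5) + m * (t - 1/5)) \<le> ln_ext (f t)"
    by (rule support_line[OF assms, of "1/5"]) auto
  obtain n where n: "\<And>t. t \<in> {0..1} \<Longrightarrow> ereal (L (2/5) + n * (t - 2/5)) \<le> ln_ext (f t)"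
    by (rule support_line[OF assms, of "2/5"]) auto
  define d where "d k l = max k l - min k l" for k l :: nat
  \<comment> \<open>\<open>s k l\<close> is the length of an arc spanning one or two consecutive
    gaps; the complement is taken for index distance 3 or 4, where the arc passes through 0. It may
    exceed 1/2, which is why the support lines are needed on all of [0,1].\<close>
  define s where "s k l = (if d k l \<le> 2 then x (max k l) - x (min k l)
      else 1 - (x (max k l) - x (min k l)))" for k l
  define b where "b k l = (if d k l = 1 \<or> d k l = 4 then L (1/5) + m * (s k l - 1/5)
      else L (2/5) + n * (s k l - 2/5))" for k l
  \<comment> \<open>The slopes cancel: the five one-step arcs sum to 1 = 5 * 1/5 and the five
    two-step arcs to 2 = 5 * 2/5, each arc being counted for both orders of its endpoints.\<close>
  have "(\<Sum>(k, l)\<in>offdiag 5. b k l) = 10 * (L (1/5) + L (2/5))"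
    by (simp add: sum_offdiag lessThan_5 b_def s_def d_def eval_nat_numeral algebra_simps)
  moreover have "ereal (b k l) \<le> ln_ext (f (x k - x l))" if "(k, l) \<in> offdiag 5" for k l
  proof -
    have kl: "k < 5" "l < 5" using that by (auto simp: offdiag_def)
    then have abs: "x (max k l) - x (min k l) = \<bar>x k - x l\<bar>"
      using sorted[of k l] sorted[of l k] by (auto simp: max_def min_def)
    have "s k l \<in> {0..1}"
      using x[OF kl(1)] x[OF kl(2)] unfolding s_def abs by auto
    moreover have "f (s k l) = f (x k - x l)"
      unfolding s_def abs by (simp add: f_1_minus f_abs)
    ultimately show ?thesis
      using m[of "s k l"] n[of "s k l"] by (simp add: b_def)
  qed
  then have "(\<Sum>(k, l)\<in>offdiag 5. ereal (b k l)) \<le> (\<Sum>(k, l)\<in>offdiag 5. ln_ext (f (x k - x l)))"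
    by (intro sum_mono) auto
  ultimately show "(\<Sum>(k, l)\<in>offdiag 5. ln_ext (f (real k / real 5 - real l / real 5)))
      \<le> (\<Sum>(k, l)\<in>offdiag 5. ln_ext (f (x k - x l)))"
    unfolding sum_ln_ext_lattice sum_ereal_offdiag by simp
qed

section \<open>Criterion (b): absolutely monotone logarithm in the cosine variable\<close>

theorem equispacing_absolutely_monotone:
  assumes h: "\<And>t. t \<notin> \<int> \<Longrightarrow> f t = ereal (h (cos (2 * pi * t)))"
    and mono: "absolutely_monotone (\<lambda>s. ln (h s))"
  shows "equispacing 5 (\<lambda>t. ln_ext (f t))"
proof -
  let ?u = "\<lambda>s. ln (h s)" and ?a = "cos (4 * pi / 5)" and ?b = "cos (2 * pi / 5)"
  have L: "L t = ?u (cos (2 * pi * t))" if "t \<notin> \<int>" for t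
    using h[OF that] by (simp add: L_def)
  have ab: "?a \<in> {-1..<1}" "?b \<in> {-1..<1}"
    using cos_monotone_0_pi[of 0 "2 * pi / 5"] cos_2_pi_5(3) by auto
  obtain \<alpha> \<beta> \<gamma> where nonneg: "0 \<le> \<alpha>" "0 \<le> \<beta>" "0 \<le> \<gamma>"
    and b: "?u ?b = ?u ?a + \<alpha> * (?b - ?a) + \<beta> * (?b - ?a)\<^sup>2"
    and le: "\<And>s. s \<in> {-1..<1} \<Longrightarrow>
      ?u ?a + \<alpha> * (s - ?a) + \<beta> * (s - ?a)\<^sup>2 + \<gamma> * (s - ?a)\<^sup>2 * (s - ?b) \<le> ?u s"
    using absolutely_monotone_Hermite_bound[OF mono ab] by blast
  \<comment> \<open>The Hermite interpolant expanded in powers of s, the form in which the signs of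
    its coefficients can be read off.\<close>
  define P where "P s = (?u ?a - \<alpha> * ?a + \<beta> * ?a\<^sup>2 - \<gamma> * ?a\<^sup>2 * ?b)
      + (\<alpha> - 2 * \<beta> * ?a + \<gamma> * (?a\<^sup>2 + 2 * ?a * ?b)) * s
      + (\<beta> - \<gamma> * (2 * ?a + ?b)) * s\<^sup>2 + \<gamma> * s ^ 3" for s
  have P: "P s = ?u ?a + \<alpha> * (s - ?a) + \<beta> * (s - ?a)\<^sup>2 + \<gamma> * (s - ?a)\<^sup>2 * (s - ?b)" for s
    by (simp add: P_def algebra_simps power2_eq_square power3_eq_cube)
  have P_le_L: "P (cos (2 * pi * t)) \<le> L t" if "\<bar>t\<bar> < 1" "t \<noteq> 0" for t
  proof -
    have t: "t \<notin> \<int>" using that by (simp add: not_Ints)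
    have "cos (2 * pi * t) \<noteq> 1"
    proof
      assume "cos (2 * pi * t) = 1"
      then obtain n :: int where "2 * pi * t = of_int n * 2 * pi"
        by (auto simp: cos_one_2pi_int)
      then have "t = of_int n" by simp
      with t show False by simp
    qed
    then have "cos (2 * pi * t) \<in> {-1..<1}"
      by (simp add: order_less_le)
    then show ?thesis
      unfolding P L[OF t] by (rule le)
  qed
  have P_le: "ereal (P (cos (2 * pi * t))) \<le> ln_ext (f t)" if "\<bar>t\<bar> < 1" for t
  proof (cases "t = 0")
    case True
    \<comment> \<open>At t = 0 the cosine is 1, outside the range of the Hermite bound, so the bound
      is obtained as a limit from the right.\<close>
    have "eventually (\<lambda>t. P (cos (2 * pi * t)) \<le> L t) (at_right 0)"
      using eventually_at_right_real[of 0 1] by (rule eventually_mono) (use P_le_L in auto)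
    moreover have "((\<lambda>t. P (cos (2 * pi * t))) \<longlongrightarrow> P (cos (2 * pi * 0))) (at_right 0)"
      unfolding P_def by (intro tendsto_intros)
    ultimately show ?thesis
      unfolding True by (intro ln_ext_f_0_ge)
  qed (use that P_le_L in \<open>auto simp: ln_ext_f not_Ints\<close>)
  show ?thesis
    unfolding equispacing_def
  proof (intro allI impI)
    fix x :: "nat \<Rightarrow> real" assume x: "\<forall>k<5. x k \<in> {0..<1}"
    have "10 * (P ?b + P ?a) \<le> (\<Sum>(k, l)\<in>offdiag 5. P (cos (2 * pi * (x k - x l))))"
      unfolding P_def
    proof (rule cubic_sum_cos_ge)
      \<comment> \<open>The sum of the two nodes is -1/2 and -1 \<le> \<open>?a\<close> \<le> -1/2.
        Hence 2 \<open>?a\<close> + \<open>?b\<close> is negative and the term multiplying \<gamma>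
        in the linear coefficient equals -\<open>?a\<close> (1 + \<open>?a\<close>) \<ge> 0.\<close>
      have b: "?b = - 1/2 - ?a" using cos_2_pi_5(2) by simp
      have "2 * ?a + ?b \<le> 0" using b cos_2_pi_5(3) by simp
      then show "0 \<le> \<beta> - \<gamma> * (2 * ?a + ?b)"
        using nonneg mult_nonneg_nonpos[of \<gamma> "2 * ?a + ?b"] by simp
      have "?a\<^sup>2 + 2 * ?a * ?b = (- ?a) * (1 + ?a)"
        unfolding b by (simp add: algebra_simps power2_eq_square)
      moreover have "0 \<le> (- ?a) * (1 + ?a)"
        using cos_2_pi_5(3) cos_ge_minus_one[of "4 * pi / 5"] by (intro mult_nonneg_nonneg) linarith+
      ultimately have "0 \<le> \<gamma> * (?a\<^sup>2 + 2 * ?a * ?b)"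
        using nonneg by (metis mult_nonneg_nonneg)
      moreover have "\<beta> * ?a \<le> 0"
        using nonneg cos_2_pi_5(3) by (intro mult_nonneg_nonpos) auto
      ultimately show "0 \<le> \<alpha> - 2 * \<beta> * ?a + \<gamma> * (?a\<^sup>2 + 2 * ?a * ?b)"
        using nonneg by simp
    qed (use nonneg in auto)
    \<comment> \<open>The interpolant agrees with the logarithm at both nodes, so the bound is sharp
      on the lattice.\<close>
    moreover have "L (1/5) = P ?b" "L (2/5) = P ?a"
      unfolding P using b by (simp_all add: L not_Ints)
    moreover have "(\<Sum>(k, l)\<in>offdiag 5. ereal (P (cos (2 * pi * (x k - x l)))))
        \<le> (\<Sum>(k, l)\<in>offdiag 5. ln_ext (f (x k - x l)))"
    proof (rule sum_mono, clarify)
      fix k l assume "(k, l) \<in> offdiag 5"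
      then have "\<bar>x k - x l\<bar> < 1"
        using x[rule_format, of k] x[rule_format, of l] by (auto simp: offdiag_def)
      then show "ereal (P (cos (2 * pi * (x k - x l)))) \<le> ln_ext (f (x k - x l))"
        by (rule P_le)
    qed
    ultimately show "(\<Sum>(k, l)\<in>offdiag 5. ln_ext (f (real k / real 5 - real l / real 5)))
        \<le> (\<Sum>(k, l)\<in>offdiag 5. ln_ext (f (x k - x l)))"
      unfolding sum_ln_ext_lattice sum_ereal_offdiag by (simp add: order.trans[rotated])
  qed
qed

end

theorem corollary2p5:
  fixes f :: "real \<Rightarrow> ereal"
  assumes "potential f"
    and "\<And>t. t \<notin> \<int> \<Longrightarrow> 0 < f t \<and> f t < \<infinity>"
  shows "(equispacing 5 (\<lambda>t. ln_ext (f t)) \<longrightarrow> energy_minimizer f 5 Fibonacci5) \<and>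
    (antimono_on {0<..1/2} f \<and> convex_on {0<..1/2} (\<lambda>t. ln (real_of_ereal (f t)))
       \<longrightarrow> energy_minimizer f 5 Fibonacci5) \<and>
    (\<forall>h :: real \<Rightarrow> real.
       (\<forall>s\<in>{-1..<1}. 0 < h s) \<and>
       (\<forall>t. t \<notin> \<int> \<longrightarrow> f t = ereal (h (cos (2 * pi * t)))) \<and>
       absolutely_monotone (\<lambda>s. ln (h s))
       \<longrightarrow> energy_minimizer f 5 Fibonacci5)"
proof -
  interpret positive_potential f
    by unfold_locales (use assms in auto)
  have L: "L = (\<lambda>t. ln (real_of_ereal (f t)))"
    by (simp add: fun_eq_iff L_def)
  show ?thesis
    using equispacing_imp_energy_minimizer equispacing_convex[unfolded L]
      equispacing_absolutely_monotone by blast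
qed

end
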